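(* There exists a sequence $(\varepsilon_k)_{k\ge 2}$ of nonnegative reals with $\varepsilon_k\to 0$ as $k\to\infty$ such that for all integers $k\geq 2$ and $n\geq 1$, $$f_2(n,k)\le \left\lfloor \frac{n}{k}\right\rfloor+(1+\varepsilon_k)\,k\binom{2k}{k}.$$ In other words, $c(k):=\sup_{n}\left\{f_2(n,k)-\lfloor n/k\rfloor\right\}\le (1+o(1))k\binom{2k}{k}$ as $k\to\infty$.
   Context: For a set $A$ and integer $k\ge1$, the Kneser graph $KG(A,k)$ has vertex set the family of all $k$-element subsets of $A$, two vertices $X,Y$ being adjacent iff $X\cap Y=\emptyset$; $KG(n,k)$ denotes a Kneser graph with an $n$-element base set. The xor-product $G\cdot H$ of graphs $G,H$ has vertex set $V(G)\times V(H)$, and $(g,h)$, $(g',h')$ are adjacent iff exactly one of the following holds: $gg'\in E(G)$, $hh'\in E(H)$. $f_\ell(n,k)$ denotes the clique number of the xor-product of $\ell$ copies of $KG(n,k)$. Equivalently, $f_2(n,k)$ is the maximum size of a family $\mathcal S$ of subsets of $A\cup B$, where $A,B$ are disjoint $n$-element sets, such that $|S\cap A|=|S\cap B|=k$ for all $S\in\mathcal S$, and any two distinct $S,T\in\mathcal S$ satisfy exactly one of $S\cap T\cap A=\emptyset$, $S\cap T\cap B=\emptyset$. *)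

theory Defs
  imports "HOL-Analysis.Analysis"
begin

type_synonym 'v graph = "'v set \<times> ('v \<Rightarrow> 'v \<Rightarrow> bool)"

definition kneser_graph :: "'a set \<Rightarrow> nat \<Rightarrow> 'a set graph" where
  "kneser_graph A k = ({X. X \<subseteq> A \<and> card X = k}, (\<lambda>X Y. X \<inter> Y = {}))"

definition KG :: "nat \<Rightarrow> nat \<Rightarrow> nat set graph" where
  "KG n k = kneser_graph {0..<n} k"

definition xor_product :: "'a graph \<Rightarrow> 'b graph \<Rightarrow> ('a \<times> 'b) graph" where
  "xor_product G H = (fst G \<times> fst H,
     (\<lambda>(g,h) (g',h'). snd G g g' \<noteq> snd H h h'))"

definition is_clique :: "'v graph \<Rightarrow> 'v set \<Rightarrow> bool" where
  "is_clique G C \<longleftrightarrow> C \<subseteq> fst G \<and> (\<forall>x\<in>C. \<forall>y\<in>C. x \<noteq> y \<longrightarrow> snd G x y)"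

definition clique_number :: "'v graph \<Rightarrow> nat" where
  "clique_number G = Sup {card C | C. finite C \<and> is_clique G C}"

definition f2 :: "nat \<Rightarrow> nat \<Rightarrow> nat" where
  "f2 n k = clique_number (xor_product (KG n k) (KG n k))"

end

theory Submission
  imports Defs "HOL-Real_Asymp.Real_Asymp" "HOL-Combinatorics.Multiset_Permutations"
begin

text \<open>
  Write a vertex of a clique as a pair (A, B). Two distinct vertices have either disjoint first
  components or disjoint second components, and double counting shows that on one side, say the
  first, every intersecting subfamily has at most 2k members. Take a maximal subfamily I with
  pairwise disjoint first components; it has at most n/k members, and every remaining vertex
  t in T has some s in I with disjoint second components. In a random ordering of the second
  ground set, the second component of t entirely precedes that of s with probability
  1 / (2k choose k). All t for which some such s occurs precede a common s, so they all meet the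
  k-set A of that s, whence at most k of them occur, except when two that share a point of A
  (and so have disjoint second components) both precede s. Such a triple occurs only with
  probability 1 / (3k choose k), which is negligible against the polynomially many triples per
  element of T. Taking expectations gives |T| \<le> (1 + o(1)) k (2k choose k).
\<close>

section \<open>Orderings in which one set precedes another\<close>

text \<open>Expressed by a single prefix length so that witnesses for different pairs can be
  compared: prefixes of the same list are nested.\<close>

definition before :: "'a list \<Rightarrow> 'a set \<Rightarrow> 'a set \<Rightarrow> bool" where
  "before xs X Y \<longleftrightarrow> (\<exists>i. X \<subseteq> set (take i xs) \<and> Y \<inter> set (take i xs) = {})"

lemma before_empty [simp]: "before xs {} Y"
  unfolding before_def by (rule exI[of _ 0]) simp

lemma before_Cons:
  assumes "X \<noteq> {}"
  shows "before (x # xs) X Y \<longleftrightarrow> x \<notin> Y \<and> before xs (X - {x}) Y"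
proof
  assume "before (x # xs) X Y"
  then obtain i where i: "X \<subseteq> set (take i (x # xs))" "Y \<inter> set (take i (x # xs)) = {}"
    unfolding before_def by blast
  with assms obtain j where "i = Suc j" by (cases i) auto
  with i show "x \<notin> Y \<and> before xs (X - {x}) Y"
    unfolding before_def by (auto intro!: exI[of _ j])
next
  assume asm: "x \<notin> Y \<and> before xs (X - {x}) Y"
  then obtain i where "X - {x} \<subseteq> set (take i xs)" "Y \<inter> set (take i xs) = {}"
    unfolding before_def by blast
  with asm show "before (x # xs) X Y"
    unfolding before_def by (intro exI[of _ "Suc i"]) auto
qed

text \<open>Condition on the first entry \<open>x\<close>. It must avoid \<open>Y\<close>; if it
  lies in \<open>X\<close>, it leaves the same problem with one point of \<open>X\<close> fewer, and
  otherwise the problem is unchanged on a smaller ground set. The induction therefore varies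
  \<open>X\<close> but keeps \<open>Y\<close>.\<close>

lemma card_permutations_before:
  assumes "finite G" "X \<subseteq> G" "Y \<subseteq> G" "X \<inter> Y = {}"
  shows "real (card {xs \<in> permutations_of_set G. before xs X Y}) =
           fact (card G) / real ((card X + card Y) choose card X)"
  using assms
proof (induction G arbitrary: X rule: finite_psubset_induct)
  case (psubset G)
  have finX: "finite X" and finY: "finite Y"
    using psubset.prems psubset.hyps by (auto intro: finite_subset)
  show ?case
  proof (cases "X = {}")
    case True
    then show ?thesis using psubset.hyps by simp
  next
    case False
    then have "G \<noteq> {}" using psubset.prems by auto
    \<comment> \<open>\<open>P x\<close> holds the admissible tails after first entry
      \<open>x\<close>; for \<open>x\<close> outside \<open>X\<close> the set \<open>X - {x}\<close>
      is just \<open>X\<close>.\<close>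
    define P where "P x = {xs \<in> permutations_of_set (G - {x}). before xs (X - {x}) Y}" for x
    have eq: "{xs \<in> permutations_of_set G. before xs X Y} = (\<Union>x\<in>G - Y. (#) x ` P x)"
      unfolding permutations_of_set_nonempty[OF \<open>G \<noteq> {}\<close>] P_def
      by (auto simp: before_Cons[OF False])
    have finP: "finite (P x)" for x unfolding P_def by simp
    have "card (\<Union>x\<in>G - Y. (#) x ` P x) = (\<Sum>x\<in>G - Y. card ((#) x ` P x))"
      by (intro card_UN_disjoint) (use psubset.hyps finP in auto)
    also have "\<dots> = (\<Sum>x\<in>G - Y. card (P x))"
      by (intro sum.cong refl card_image) auto
    also have "\<dots> = (\<Sum>x\<in>G - Y - X. card (P x)) + (\<Sum>x\<in>X. card (P x))"
      by (rule sum.subset_diff) (use psubset in auto)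
    also have "\<dots> = (\<Sum>x\<in>X. card (P x)) + (\<Sum>x\<in>G - Y - X. card (P x))"
      by (rule add.commute)
    finally have cnt: "card {xs \<in> permutations_of_set G. before xs X Y} = \<dots>"
      unfolding eq .
    obtain a where a: "card X = Suc a"
      using False finX by (cases "card X") auto
    obtain N where N: "card G = Suc N"
      using \<open>G \<noteq> {}\<close> psubset.hyps by (cases "card G") auto
    let ?b = "card Y"
    have PX: "real (card (P x)) = fact N / real ((a + ?b) choose a)" if "x \<in> X" for x
    proof -
      have xG: "x \<in> G" using that psubset.prems by auto
      have "real (card (P x)) = fact (card (G - {x})) /
          real ((card (X - {x}) + ?b) choose card (X - {x}))"
        unfolding P_def by (rule psubset.IH) (use that xG psubset.prems in auto)
      then show ?thesis using that xG a N psubset.hyps finX by simp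
    qed
    have PO: "real (card (P x)) = fact N / real ((Suc a + ?b) choose Suc a)"
      if "x \<in> G - Y - X" for x
    proof -
      have "real (card (P x)) = fact (card (G - {x})) /
          real ((card (X - {x}) + ?b) choose card (X - {x}))"
        unfolding P_def by (rule psubset.IH) (use that psubset.prems in auto)
      then show ?thesis using that a N psubset.hyps by simp
    qed
    have "card (X \<union> Y) = Suc a + ?b"
      using card_Un_disjoint[of X Y] psubset.prems finX finY a by simp
    moreover have "card (X \<union> Y) \<le> card G"
      using psubset.prems psubset.hyps by (intro card_mono) auto
    moreover have "G - Y - X = G - (X \<union> Y)" by auto
    ultimately have cO: "real (card (G - Y - X)) = real (Suc N) - real (Suc a + ?b)"
      using N psubset.prems finX finY by (simp add: card_Diff_subset of_nat_diff)
    \<comment> \<open>The absorption identity brings both kinds of first entry to the same binomial;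
      the term \<open>Suc a + ?b\<close> then cancels and leaves the factor
      \<open>Suc N\<close>.\<close>
    have absorb: "real (Suc a) / real ((a + ?b) choose a) =
        real (Suc a + ?b) / real ((Suc a + ?b) choose Suc a)"
    proof -
      have "real (Suc a) * real (Suc (a + ?b) choose Suc a) =
          real (Suc (a + ?b)) * real ((a + ?b) choose a)"
        using Suc_times_binomial[of a "a + ?b"] by (metis of_nat_mult)
      moreover have "real ((a + ?b) choose a) > 0" "real ((Suc a + ?b) choose Suc a) > 0"
        by (simp_all del: binomial_Suc_Suc)
      ultimately show ?thesis by (simp add: field_simps del: binomial_Suc_Suc)
    qed
    have "real (card {xs \<in> permutations_of_set G. before xs X Y}) =
        real (Suc a) * (fact N / real ((a + ?b) choose a)) +
        (real (Suc N) - real (Suc a + ?b)) * (fact N / real ((Suc a + ?b) choose Suc a))"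
      unfolding cnt of_nat_add of_nat_sum using PX PO a cO by simp
    also have "\<dots> = fact N * (real (Suc a) / real ((a + ?b) choose a)) +
        (real (Suc N) - real (Suc a + ?b)) * (fact N / real ((Suc a + ?b) choose Suc a))"
      by simp
    also have "\<dots> = fact (Suc N) / real ((Suc a + ?b) choose Suc a)"
      unfolding absorb by (simp add: diff_divide_distrib add_divide_distrib algebra_simps del: binomial_Suc_Suc)
    finally show ?thesis using a N by simp
  qed
qed

section \<open>Counting by injections\<close>

text \<open>Picking a point of \<open>f r \<inter> Z\<close> for each such \<open>r\<close> is
  injective, since a point lies in at most one of the disjoint sets.\<close>

lemma card_meeting_disjoint_family:
  assumes "finite Z" "\<And>r s. r \<in> R \<Longrightarrow> s \<in> R \<Longrightarrow> r \<noteq> s \<Longrightarrow> f r \<inter> f s = {}"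
  shows "card {r \<in> R. f r \<inter> Z \<noteq> {}} \<le> card Z"
proof -
  define g where "g r = (SOME z. z \<in> f r \<inter> Z)" for r
  have g: "g r \<in> f r \<inter> Z" if "f r \<inter> Z \<noteq> {}" for r
    unfolding g_def using that some_in_eq[of "f r \<inter> Z"] by simp
  show ?thesis
  proof (rule card_inj_on_le[of g])
    show "inj_on g {r \<in> R. f r \<inter> Z \<noteq> {}}"
    proof (rule inj_onI, rule ccontr)
      fix x y assume xy: "x \<in> {r \<in> R. f r \<inter> Z \<noteq> {}}" "y \<in> {r \<in> R. f r \<inter> Z \<noteq> {}}"
        "g x = g y" "x \<noteq> y"
      then show False using g[of x] g[of y] assms(2)[of x y] by auto
    qed
  qed (use g \<open>finite Z\<close> in auto)
qed

text \<open>Keep one representative \<open>g x\<close> per fibre of \<open>f\<close>; each discarded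
  \<open>x\<close> is charged to the collision \<open>(x, g x)\<close>.\<close>

lemma card_le_card_image_plus_collisions:
  assumes "finite S"
  shows "card S \<le> card (f ` S) + card {(x, y). x \<in> S \<and> y \<in> S \<and> x \<noteq> y \<and> f x = f y}"
    (is "_ \<le> _ + card ?P")
proof -
  define g where "g x = inv_into S f (f x)" for x
  have g: "g x \<in> S" "f (g x) = f x" if "x \<in> S" for x
    unfolding g_def using that by (auto intro: inv_into_into f_inv_into_f)
  let ?D = "S - g ` S"
  have "finite ?P"
    by (rule finite_subset[of _ "S \<times> S"]) (use assms in auto)
  have "card ?D \<le> card ?P"
  proof (rule card_inj_on_le[of "\<lambda>x. (x, g x)"])
    show "(\<lambda>x. (x, g x)) ` ?D \<subseteq> ?P"
      using g by auto
  qed (use \<open>finite ?P\<close> in \<open>auto simp: inj_on_def\<close>)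
  moreover have "card (g ` S) \<le> card (f ` S)"
  proof -
    have "g ` S = inv_into S f ` f ` S" unfolding g_def by auto
    then show ?thesis using assms by (simp add: card_image_le)
  qed
  moreover have "card S \<le> card (g ` S) + card ?D"
    using card_Un_le[of "g ` S" ?D] g by (metis Un_Diff_cancel image_subsetI sup.absorb2)
  ultimately show ?thesis by linarith
qed

section \<open>Families with the xor property\<close>

text \<open>The components of a vertex are kept as functions \<open>a\<close> and \<open>b\<close>,
  so that exchanging the two sides is a reinterpretation of the locale.\<close>

locale xor_family =
  fixes C :: "'v set" and a b :: "'v \<Rightarrow> nat set" and k n :: nat
  assumes fin: "finite C" and k_pos: "k \<ge> 1"
    and a_sub: "\<And>x. x \<in> C \<Longrightarrow> a x \<subseteq> {0..<n}" and b_sub: "\<And>x. x \<in> C \<Longrightarrow> b x \<subseteq> {0..<n}"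
    and card_a: "\<And>x. x \<in> C \<Longrightarrow> card (a x) = k" and card_b: "\<And>x. x \<in> C \<Longrightarrow> card (b x) = k"
    and xor: "\<And>x y. x \<in> C \<Longrightarrow> y \<in> C \<Longrightarrow> x \<noteq> y \<Longrightarrow> (a x \<inter> a y = {}) \<noteq> (b x \<inter> b y = {})"
begin

lemma swap: "xor_family C b a k n"
  by unfold_locales (use fin k_pos a_sub b_sub card_a card_b xor in blast)+

lemma fin_a: "x \<in> C \<Longrightarrow> finite (a x)"
  by (rule finite_subset[OF a_sub]) simp_all

lemma fin_b: "x \<in> C \<Longrightarrow> finite (b x)"
  by (rule finite_subset[OF b_sub]) simp_all

lemma a_nonempty: "x \<in> C \<Longrightarrow> a x \<noteq> {}"
  using card_a[of x] k_pos by auto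

lemma card_disjoint_family_le:
  assumes "R \<subseteq> C" "\<And>r s. r \<in> R \<Longrightarrow> s \<in> R \<Longrightarrow> r \<noteq> s \<Longrightarrow> a r \<inter> a s = {}"
  shows "card R \<le> n div k"
proof -
  have "card R * k = (\<Sum>r\<in>R. card (a r))"
    using assms(1) card_a by (simp add: subset_iff)
  also have "\<dots> = card (\<Union>r\<in>R. a r)"
    by (rule card_UN_disjoint[symmetric])
      (use assms fin fin_a in \<open>auto intro: finite_subset\<close>)
  also have "\<dots> \<le> card {0..<n}"
    using a_sub assms(1) by (intro card_mono) blast+
  finally show ?thesis
    using k_pos by (simp add: less_eq_div_iff_mult_less_eq)
qed

text \<open>Any \<open>r\<close> in \<open>R\<close> and \<open>l\<close> in \<open>L\<close> meet
  in some component. Each \<open>l\<close> meets at most \<open>k\<close> members of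
  \<open>R\<close> in the first one, and each \<open>r\<close> at most \<open>k\<close> members of
  \<open>L\<close> in the second, so |R| |L| \<le> k (|R| + |L|), which fails if both sizes exceed
  2k. By the xor property, \<open>L\<close> is intersecting in the first component.\<close>

lemma small_disjoint_or_small_intersecting:
  assumes "R \<subseteq> C" "\<And>r s. r \<in> R \<Longrightarrow> s \<in> R \<Longrightarrow> r \<noteq> s \<Longrightarrow> a r \<inter> a s = {}"
    and "L \<subseteq> C" "\<And>r s. r \<in> L \<Longrightarrow> s \<in> L \<Longrightarrow> r \<noteq> s \<Longrightarrow> b r \<inter> b s = {}"
  shows "card R \<le> 2 * k \<or> card L \<le> 2 * k"
proof -
  have finR: "finite R" and finL: "finite L"
    using assms(1,3) fin by (auto intro: finite_subset)
  define U where "U = (SIGMA l:L. {r \<in> R. a r \<inter> a l \<noteq> {}})"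
  define V where "V = (SIGMA r:R. {l \<in> L. b l \<inter> b r \<noteq> {}})"
  have "card U = (\<Sum>l\<in>L. card {r \<in> R. a r \<inter> a l \<noteq> {}})"
    unfolding U_def using finR finL by (simp add: card_SigmaI)
  also have "\<dots> \<le> (\<Sum>l\<in>L. k)"
  proof (rule sum_mono)
    fix l assume "l \<in> L"
    then have "l \<in> C" using assms(3) by auto
    then show "card {r \<in> R. a r \<inter> a l \<noteq> {}} \<le> k"
      using card_meeting_disjoint_family[of "a l" R a] assms(2) fin_a card_a by simp
  qed
  finally have U: "card U \<le> card L * k" by simp
  have "card V = (\<Sum>r\<in>R. card {l \<in> L. b l \<inter> b r \<noteq> {}})"
    unfolding V_def using finR finL by (simp add: card_SigmaI)
  also have "\<dots> \<le> (\<Sum>r\<in>R. k)"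
  proof (rule sum_mono)
    fix r assume "r \<in> R"
    then have "r \<in> C" using assms(1) by auto
    then show "card {l \<in> L. b l \<inter> b r \<noteq> {}} \<le> k"
      using card_meeting_disjoint_family[of "b r" L b] assms(4) fin_b card_b by simp
  qed
  finally have V: "card V \<le> card R * k" by simp
  have "R \<times> L \<subseteq> prod.swap ` U \<union> V"
  proof
    fix p assume "p \<in> R \<times> L"
    then obtain r l where p: "p = (r, l)" "r \<in> R" "l \<in> L" by auto
    then have "r \<in> C" "l \<in> C" using assms by auto
    \<comment> \<open>The case \<open>r = l\<close> is possible; a nonempty set then meets
      itself.\<close>
    then have "a r \<inter> a l \<noteq> {} \<or> b l \<inter> b r \<noteq> {}"
      using xor[of r l] a_nonempty[of r] by (cases "r = l") auto
    then show "p \<in> prod.swap ` U \<union> V"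
      unfolding U_def V_def using p by force
  qed
  moreover have "finite U" "finite V" unfolding U_def V_def using finR finL by auto
  ultimately have "card (R \<times> L) \<le> card (prod.swap ` U) + card V"
    by (meson card_Un_le card_mono finite_UnI finite_imageI le_trans)
  also have "\<dots> \<le> card L * k + card R * k"
    using U V card_image_le[OF \<open>finite U\<close>, of prod.swap] by linarith
  finally have *: "card R * card L \<le> card L * k + card R * k"
    by (simp add: card_cartesian_product)
  show ?thesis
  proof (rule ccontr)
    assume "\<not> ?thesis"
    then have R: "2 * k < card R" and L: "2 * k < card L" by auto
    have "2 * (card R * card L) \<le> card L * (2 * k) + card R * (2 * k)"
      using * by (simp add: algebra_simps)
    also have "\<dots> < card L * card R + card R * card L"
      using R L by (intro add_strict_mono mult_strict_left_mono) auto
    finally show False by simp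
  qed
qed

text \<open>The members whose first component contains a fixed point \<open>e\<close> form an
  intersecting family; sum over the \<open>k\<close> points of \<open>a s\<close>.\<close>

lemma card_neighbourhood_le:
  assumes w: "\<And>Q. Q \<subseteq> C \<Longrightarrow> (\<And>r s. r \<in> Q \<Longrightarrow> s \<in> Q \<Longrightarrow> a r \<inter> a s \<noteq> {}) \<Longrightarrow> card Q \<le> w"
    and "s \<in> C"
  shows "card {t \<in> C. a t \<inter> a s \<noteq> {}} \<le> k * w"
proof -
  have "{t \<in> C. a t \<inter> a s \<noteq> {}} = (\<Union>e\<in>a s. {t \<in> C. e \<in> a t})" by auto
  also have "card \<dots> \<le> (\<Sum>e\<in>a s. card {t \<in> C. e \<in> a t})"
    using assms fin_a by (intro card_UN_le) auto
  also have "\<dots> \<le> (\<Sum>e\<in>a s. w)"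
    by (intro sum_mono w) auto
  finally show ?thesis using card_a assms by simp
qed

section \<open>The probabilistic bound\<close>

text \<open>The argument runs twice: a crude bound k w M on |T| comes first and is then fed into the
  error term. Each member of T lies in at most k k w triples, each of probability 1 / M', which
  explains the factor (k w)^2 M / M'.\<close>

lemma card_le:
  assumes w: "\<And>Q. Q \<subseteq> C \<Longrightarrow> (\<And>r s. r \<in> Q \<Longrightarrow> s \<in> Q \<Longrightarrow> a r \<inter> a s \<noteq> {}) \<Longrightarrow> card Q \<le> w"
  defines "M \<equiv> real ((2 * k) choose k)" and "M' \<equiv> real ((3 * k) choose k)"
  shows "real (card C) \<le> real (n div k) + (1 + (real k * real w)\<^sup>2 * M / M') * real k * M"
proof -
  define indep where "indep R \<longleftrightarrow> R \<subseteq> C \<and> (\<forall>r\<in>R. \<forall>s\<in>R. r \<noteq> s \<longrightarrow> a r \<inter> a s = {})" for R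
  have "finite {R. indep R}"
    by (rule finite_subset[of _ "Pow C"]) (auto simp: indep_def fin)
  moreover have "indep {}" by (simp add: indep_def)
  ultimately obtain I where I: "indep I" and max: "\<And>R. indep R \<Longrightarrow> I \<subseteq> R \<Longrightarrow> R = I"
    using finite_has_maximal[of "{R. indep R}"] by (metis empty_iff mem_Collect_eq)
  have IC: "I \<subseteq> C" and Idis: "\<And>r s. r \<in> I \<Longrightarrow> s \<in> I \<Longrightarrow> r \<noteq> s \<Longrightarrow> a r \<inter> a s = {}"
    using I by (auto simp: indep_def)
  define T where "T = C - I"
  have finI: "finite I" and finT: "finite T" and TC: "T \<subseteq> C"
    using IC fin by (auto simp: T_def intro: finite_subset)
  have adj: "a t \<inter> a s \<noteq> {} \<longleftrightarrow> b t \<inter> b s = {}" if "t \<in> T" "s \<in> I" for t s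
    using xor[of t s] that IC by (auto simp: T_def)
  have "\<exists>s\<in>I. a t \<inter> a s \<noteq> {}" if t: "t \<in> T" for t
  proof (rule ccontr)
    assume "\<not> ?thesis"
    then have "indep (insert t I)"
      using I t TC by (auto simp: indep_def)
    then show False using max t by (auto simp: T_def)
  qed
  then obtain \<sigma> where \<sigma>: "\<And>t. t \<in> T \<Longrightarrow> \<sigma> t \<in> I \<and> a t \<inter> a (\<sigma> t) \<noteq> {}" by metis

  define Ps where "Ps = permutations_of_set {0..<n}"
  \<comment> \<open>Probabilities are counts over the orderings in \<open>Ps\<close>.\<close>
  define T0 where "T0 xs = {t \<in> T. \<exists>s\<in>I. before xs (b t) (b s)}" for xs
  \<comment> \<open>Candidate triples: the disjointness of \<open>b t\<close> and
    \<open>b t'\<close> makes their union a set of 2k points, so that both precede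
    \<open>b s\<close> with probability only 1 / M'.\<close>
  define Tri where "Tri = {(t, s, t'). t \<in> T \<and> s \<in> I \<and> t' \<in> T \<and>
     a t \<inter> a s \<noteq> {} \<and> a t' \<inter> a s \<noteq> {} \<and> b t \<inter> b t' = {}}"
  define Tr where "Tr xs = {(t, s, t') \<in> Tri. before xs (b t \<union> b t') (b s)}" for xs
  have finPs: "finite Ps" and cardPs: "card Ps = fact n" by (simp_all add: Ps_def)
  have finT0: "finite (T0 xs)" for xs using finT by (simp add: T0_def)
  have "finite Tri"
    by (rule finite_subset[of _ "T \<times> I \<times> T"]) (use finT finI in \<open>auto simp: Tri_def\<close>)
  then have finTr: "finite (Tr xs)" for xs
    unfolding Tr_def by (rule rev_finite_subset) auto
  have Mpos: "M > 0" "M' > 0" unfolding M_def M'_def by auto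

  \<comment> \<open>For each \<open>t\<close> the single witness \<open>\<sigma> t\<close> already
    gives probability 1 / M; exchanging the sums yields the expected size of
    \<open>T0\<close>.\<close>
  have lower: "real (card T) * fact n / M \<le> (\<Sum>xs\<in>Ps. real (card (T0 xs)))"
  proof -
    have "real (card T) * fact n / M = (\<Sum>t\<in>T. fact n / M)" by simp
    also have "\<dots> \<le> (\<Sum>t\<in>T. real (card {xs \<in> Ps. t \<in> T0 xs}))"
    proof (rule sum_mono)
      fix t assume t: "t \<in> T"
      have mem: "t \<in> C" "\<sigma> t \<in> C" using t \<sigma>[OF t] TC IC by auto
      have "b t \<inter> b (\<sigma> t) = {}" using adj t \<sigma>[OF t] by blast
      then have "fact n / M = real (card {xs \<in> Ps. before xs (b t) (b (\<sigma> t))})"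
        unfolding Ps_def
        using card_permutations_before[of "{0..<n}" "b t" "b (\<sigma> t)"] b_sub card_b mem
        by (simp add: M_def mult_2)
      also have "\<dots> \<le> real (card {xs \<in> Ps. t \<in> T0 xs})"
        unfolding of_nat_le_iff
        by (rule card_mono) (use finPs t \<sigma>[OF t] in \<open>auto simp: T0_def\<close>)
      finally show "fact n / M \<le> \<dots>" .
    qed
    also have "\<dots> = real (\<Sum>t\<in>T. card {xs \<in> Ps. t \<in> T0 xs})" by simp
    also have "(\<Sum>t\<in>T. card {xs \<in> Ps. t \<in> T0 xs}) = (\<Sum>xs\<in>Ps. card {t \<in> T. t \<in> T0 xs})"
      by (rule sum_multicount_gen[symmetric]) (use finT finPs in auto)
    also have "\<dots> = (\<Sum>xs\<in>Ps. card (T0 xs))"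
      by (intro sum.cong arg_cong[where f = card]) (auto simp: T0_def)
    finally show ?thesis by simp
  qed

  \<comment> \<open>The longest witnessing prefix contains all the others, so the \<open>s\<close>
    that belongs to it serves every \<open>t\<close>.\<close>
  have last: "\<exists>s\<in>I. \<exists>i. \<forall>t\<in>T0 xs. b t \<subseteq> set (take i xs) \<and> b s \<inter> set (take i xs) = {}"
    if "T0 xs \<noteq> {}" for xs
  proof -
    have "\<forall>t\<in>T0 xs. \<exists>s i. s \<in> I \<and> b t \<subseteq> set (take i xs) \<and> b s \<inter> set (take i xs) = {}"
      by (auto simp: T0_def before_def)
    then obtain s i where si: "\<And>t. t \<in> T0 xs \<Longrightarrow>
        s t \<in> I \<and> b t \<subseteq> set (take (i t) xs) \<and> b (s t) \<inter> set (take (i t) xs) = {}"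
      by metis
    obtain m where m: "m \<in> T0 xs" "\<And>t. t \<in> T0 xs \<Longrightarrow> i t \<le> i m"
    proof -
      have "Max (i ` T0 xs) \<in> i ` T0 xs" using finT0 \<open>T0 xs \<noteq> {}\<close> by simp
      then obtain m where "m \<in> T0 xs" "i m = Max (i ` T0 xs)" by auto
      then show ?thesis using that[of m] finT0 by simp
    qed
    have "b t \<subseteq> set (take (i m) xs)" if t: "t \<in> T0 xs" for t
      using si[OF t] set_take_subset_set_take[OF m(2)[OF t], of xs] by blast
    then show ?thesis using si[OF m(1)] by blast
  qed

  have T0_le: "card (T0 xs) \<le> k * w" and T0_Tr: "card (T0 xs) \<le> k + card (Tr xs)" for xs
  proof -
    have "card (T0 xs) \<le> k * w \<and> card (T0 xs) \<le> k + card (Tr xs)"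
    proof (cases "T0 xs = {}")
      case False
      then obtain s i where s: "s \<in> I"
        and i: "\<And>t. t \<in> T0 xs \<Longrightarrow> b t \<subseteq> set (take i xs)" "b s \<inter> set (take i xs) = {}"
        using last by blast
      have T0T: "T0 xs \<subseteq> T" by (auto simp: T0_def)
      \<comment> \<open>\<open>b t\<close> lies in a prefix that \<open>b s\<close> avoids, so the
        second components are disjoint and the first ones must meet.\<close>
      have meet: "a t \<inter> a s \<noteq> {}" if "t \<in> T0 xs" for t
        using adj[of t s] i that s T0T by blast
      have "card (T0 xs) \<le> card {t \<in> C. a t \<inter> a s \<noteq> {}}"
        by (rule card_mono) (use fin meet T0T TC in auto)
      also have "\<dots> \<le> k * w"
        using card_neighbourhood_le[OF w, of s] s IC by blast
      finally have le: "card (T0 xs) \<le> k * w" .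
      \<comment> \<open>\<open>e\<close> takes at most \<open>k\<close> values, all in
        \<open>a s\<close>. A collision of \<open>e\<close> is a common point of two first
        components, which forces disjoint second components and hence a triple in
        \<open>Tr xs\<close>.\<close>
      define e where "e t = (SOME x. x \<in> a t \<inter> a s)" for t
      have e: "e t \<in> a t \<inter> a s" if "t \<in> T0 xs" for t
        unfolding e_def using meet[OF that] some_in_eq[of "a t \<inter> a s"] by simp
      let ?P = "{(x, y). x \<in> T0 xs \<and> y \<in> T0 xs \<and> x \<noteq> y \<and> e x = e y}"
      have "card (T0 xs) \<le> card (e ` T0 xs) + card ?P"
        by (rule card_le_card_image_plus_collisions[OF finT0])
      also have "card (e ` T0 xs) \<le> card (a s)"
        using e fin_a s IC by (intro card_mono) auto
      also have "\<dots> = k" using card_a s IC by auto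
      also have "card ?P \<le> card (Tr xs)"
      proof (rule card_inj_on_le[of "\<lambda>(x, y). (x, s, y)"])
        show "(\<lambda>(x, y). (x, s, y)) ` ?P \<subseteq> Tr xs"
        proof clarify
          fix x y assume xy: "x \<in> T0 xs" "y \<in> T0 xs" "x \<noteq> y" "e x = e y"
          then have "a x \<inter> a y \<noteq> {}" using e by (metis IntD1 IntI empty_iff)
          then have "b x \<inter> b y = {}" using xor[of x y] xy T0T TC by blast
          moreover have "before xs (b x \<union> b y) (b s)"
            unfolding before_def using i xy by blast
          ultimately show "(x, s, y) \<in> Tr xs"
            using xy T0T s meet by (auto simp: Tr_def Tri_def)
        qed
      qed (use finTr in \<open>auto simp: inj_on_def\<close>)
      finally show ?thesis using le by simp
    qed simp
    then show "card (T0 xs) \<le> k * w" "card (T0 xs) \<le> k + card (Tr xs)" by auto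
  qed

  \<comment> \<open>The crude bound: \<open>T0 xs\<close> never exceeds a neighbourhood of one
    \<open>s\<close>, while its average is at least |T| / M.\<close>
  have T_le: "real (card T) \<le> real k * real w * M"
  proof -
    have "(\<Sum>xs\<in>Ps. real (card (T0 xs))) \<le> (\<Sum>xs\<in>Ps. real (k * w))"
      using T0_le by (intro sum_mono) (simp only: of_nat_le_iff)
    also have "\<dots> = real k * real w * fact n" using cardPs by simp
    finally have "fact n * (real (card T) / M) \<le> fact n * (real k * real w)"
      using lower by (simp add: mult.commute)
    then have "real (card T) / M \<le> real k * real w"
      by (rule mult_left_le_imp_le) simp
    then show ?thesis using Mpos by (simp add: field_simps)
  qed

  \<comment> \<open>Choose \<open>t\<close>, then one of at most \<open>k\<close> members of
    \<open>I\<close> meeting it (their first components are disjoint), then \<open>t'\<close> among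
    at most \<open>k * w\<close> neighbours of that member.\<close>
  have Tri_le: "card Tri \<le> card T * (k * (k * w))"
  proof -
    have "Tri \<subseteq> (SIGMA t:T. SIGMA s:{s \<in> I. a s \<inter> a t \<noteq> {}}. {t' \<in> C. a t' \<inter> a s \<noteq> {}})"
      (is "_ \<subseteq> ?S") using TC by (auto simp: Tri_def)
    then have "card Tri \<le> card ?S"
      by (rule card_mono[rotated]) (use finT finI fin in auto)
    also have "\<dots> = (\<Sum>t\<in>T. \<Sum>s\<in>{s \<in> I. a s \<inter> a t \<noteq> {}}. card {t' \<in> C. a t' \<inter> a s \<noteq> {}})"
      using finT finI fin by (simp add: card_SigmaI)
    also have "\<dots> \<le> (\<Sum>t\<in>T. \<Sum>s\<in>{s \<in> I. a s \<inter> a t \<noteq> {}}. k * w)"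
      using card_neighbourhood_le[OF w] IC by (intro sum_mono) blast
    also have "\<dots> = (\<Sum>t\<in>T. card {s \<in> I. a s \<inter> a t \<noteq> {}} * (k * w))" by simp
    also have "\<dots> \<le> (\<Sum>t\<in>T. k * (k * w))"
    proof (intro sum_mono mult_right_mono)
      fix t assume "t \<in> T"
      then have t: "t \<in> C" using TC by auto
      show "card {s \<in> I. a s \<inter> a t \<noteq> {}} \<le> k"
        using card_meeting_disjoint_family[of "a t" I a] fin_a[OF t] card_a[OF t] Idis by simp
    qed simp
    finally show ?thesis by simp
  qed

  have "(\<Sum>xs\<in>Ps. real (card (Tr xs))) = real (\<Sum>xs\<in>Ps. card {p \<in> Tri. p \<in> Tr xs})"
    unfolding of_nat_sum
    by (intro sum.cong refl arg_cong[where f = "\<lambda>S. real (card S)"]) (auto simp: Tr_def)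
  also have "(\<Sum>xs\<in>Ps. card {p \<in> Tri. p \<in> Tr xs}) = (\<Sum>p\<in>Tri. card {xs \<in> Ps. p \<in> Tr xs})"
    by (rule sum_multicount_gen) (use \<open>finite Tri\<close> finPs in auto)
  also have "real \<dots> = (\<Sum>p\<in>Tri. real (card {xs \<in> Ps. p \<in> Tr xs}))" by simp
  also have "\<dots> = (\<Sum>p\<in>Tri. fact n / M')"
  proof (rule sum.cong[OF refl])
    fix p assume "p \<in> Tri"
    then obtain t s t' where p: "p = (t, s, t')" "t \<in> T" "s \<in> I" "t' \<in> T"
      "a t \<inter> a s \<noteq> {}" "a t' \<inter> a s \<noteq> {}" "b t \<inter> b t' = {}"
      by (auto simp: Tri_def)
    have dis: "b t \<inter> b s = {}" "b t' \<inter> b s = {}" using adj p by auto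
    have mem: "t \<in> C" "s \<in> C" "t' \<in> C" using p TC IC by auto
    have "card (b t \<union> b t') = 2 * k"
      using card_Un_disjoint[of "b t" "b t'"] p(7) mem fin_b card_b by simp
    \<comment> \<open>The count produces 3k choose 2k, which equals \<open>M'\<close> by
      symmetry.\<close>
    then have "real (card {xs \<in> Ps. before xs (b t \<union> b t') (b s)}) = fact n / M'"
      unfolding Ps_def
      by (subst card_permutations_before)
        (use dis mem b_sub card_b binomial_symmetric[of k "3 * k"] in \<open>auto simp: M'_def\<close>)
    then show "real (card {xs \<in> Ps. p \<in> Tr xs}) = fact n / M'"
      using \<open>p \<in> Tri\<close> p(1) by (simp add: Tr_def)
  qed
  also have "\<dots> = real (card Tri) * (fact n / M')" by simp
  also have "\<dots> \<le> real (card T * (k * (k * w))) * (fact n / M')"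
    using Tri_le Mpos by (intro mult_right_mono) (simp_all only: of_nat_le_iff, simp)
  finally have Tr_sum: "(\<Sum>xs\<in>Ps. real (card (Tr xs))) \<le> \<dots>" .

  have "(\<Sum>xs\<in>Ps. real (card (T0 xs))) \<le> (\<Sum>xs\<in>Ps. real k + real (card (Tr xs)))"
    using T0_Tr by (intro sum_mono) (simp only: of_nat_add[symmetric] of_nat_le_iff)
  also have "\<dots> = real k * fact n + (\<Sum>xs\<in>Ps. real (card (Tr xs)))"
    using cardPs by (simp add: sum.distrib)
  finally have "fact n * (real (card T) / M) \<le>
      fact n * (real k + real (card T) * (real k * (real k * real w)) / M')"
    using lower Tr_sum by (simp add: algebra_simps)
  then have "real (card T) / M \<le> real k + real (card T) * (real k * (real k * real w)) / M'"
    by (rule mult_left_le_imp_le) simp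
  then have "real (card T) \<le> (real k + real (card T) * (real k * (real k * real w)) / M') * M"
    using Mpos by (simp add: pos_divide_le_eq)
  \<comment> \<open>Only the occurrence of |T| on the right is replaced by its crude bound.\<close>
  also have "\<dots> \<le> (real k + (real k * real w * M) * (real k * (real k * real w)) / M') * M"
    using Mpos T_le by (intro mult_right_mono add_left_mono divide_right_mono) auto
  also have "\<dots> = (1 + (real k * real w)\<^sup>2 * M / M') * real k * M"
    by (simp add: power2_eq_square algebra_simps)
  finally have "real (card T) \<le> \<dots>" .
  moreover have "card C = card I + card T"
    unfolding T_def using card_Diff_subset[OF finI IC] card_mono[OF fin IC] by simp
  moreover have "card I \<le> n div k"
    using card_disjoint_family_le IC Idis by blast
  ultimately show ?thesis by linarith
qed

end

section \<open>Decay of the binomial ratio\<close>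

text \<open>Compare the product formulas factor by factor: 3 (2k - i) \<le> 2 (3k - i).\<close>

lemma central_binomial_ratio_le:
  "real ((2 * k) choose k) / real ((3 * k) choose k) \<le> (2 / 3) ^ k"
proof -
  have "real ((2 * k) choose k) = (\<Prod>i = 0..<k. real (2 * k - i) / real (k - i))"
    by (rule binomial_altdef_of_nat) simp
  also have "\<dots> \<le> (\<Prod>i = 0..<k. (2 / 3) * (real (3 * k - i) / real (k - i)))"
    by (intro prod_mono conjI) (auto simp: field_simps of_nat_diff intro!: mult_left_mono)
  also have "\<dots> = (2 / 3) ^ k * (\<Prod>i = 0..<k. real (3 * k - i) / real (k - i))"
    by (simp only: prod.distrib prod_constant card_atLeastLessThan diff_zero)
  also have "(\<Prod>i = 0..<k. real (3 * k - i) / real (k - i)) = real ((3 * k) choose k)"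
    by (rule binomial_altdef_of_nat[symmetric]) simp
  finally show ?thesis by (simp add: divide_le_eq)
qed

section \<open>Cliques of the xor-product and the final estimate\<close>

text \<open>This is the bound with w = 2k, on whichever side all intersecting families are that
  small. If both sides failed, the two large families would be pairwise disjoint in the opposite
  components, against the double counting.\<close>

lemma clique_xor_KG_card_le:
  assumes "k \<ge> 1" "finite C" "is_clique (xor_product (KG n k) (KG n k)) C"
  shows "real (card C) \<le> real (n div k) +
    (1 + (real k * real (2 * k))\<^sup>2 * real ((2 * k) choose k) / real ((3 * k) choose k))
      * real k * real ((2 * k) choose k)"
proof -
  have vertex: "fst x \<subseteq> {0..<n} \<and> snd x \<subseteq> {0..<n} \<and> card (fst x) = k \<and> card (snd x) = k"
    if "x \<in> C" for x
  proof -
    have "x \<in> {X. X \<subseteq> {0..<n} \<and> card X = k} \<times> {X. X \<subseteq> {0..<n} \<and> card X = k}"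
      using assms(3) that
      unfolding is_clique_def xor_product_def KG_def kneser_graph_def by auto
    then show ?thesis by (simp add: mem_Times_iff)
  qed
  have edge: "(fst x \<inter> fst y = {}) \<noteq> (snd x \<inter> snd y = {})"
    if "x \<in> C" "y \<in> C" "x \<noteq> y" for x y
    using assms(3) that
    unfolding is_clique_def xor_product_def KG_def kneser_graph_def
    by (simp add: case_prod_beta)
  interpret A: xor_family C fst snd k n
    by unfold_locales (use assms vertex edge in blast)+
  interpret B: xor_family C snd fst k n by (rule A.swap)
  let ?small = "\<lambda>f. \<forall>Q\<subseteq>C. (\<forall>r\<in>Q. \<forall>s\<in>Q. f r \<inter> f s \<noteq> {}) \<longrightarrow> card Q \<le> 2 * k"
  have "?small fst \<or> ?small snd"
  proof (rule ccontr)
    assume "\<not> ?thesis"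
    then have "\<not> ?small fst" "\<not> ?small snd" by simp_all
    then obtain L R where L: "L \<subseteq> C" "\<forall>r\<in>L. \<forall>s\<in>L. fst r \<inter> fst s \<noteq> {}" "\<not> card L \<le> 2 * k"
      and R: "R \<subseteq> C" "\<forall>r\<in>R. \<forall>s\<in>R. snd r \<inter> snd s \<noteq> {}" "\<not> card R \<le> 2 * k"
      by blast
    have "card R \<le> 2 * k \<or> card L \<le> 2 * k"
    proof (rule A.small_disjoint_or_small_intersecting)
      show "fst r \<inter> fst s = {}" if "r \<in> R" "s \<in> R" "r \<noteq> s" for r s
        using A.xor[of r s] R(2) subsetD[OF R(1)] that by simp
      show "snd r \<inter> snd s = {}" if "r \<in> L" "s \<in> L" "r \<noteq> s" for r s
        using A.xor[of r s] L(2) subsetD[OF L(1)] that by simp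
    qed (use L R in simp_all)
    then show False using L R by simp
  qed
  then show ?thesis
  proof
    assume "?small fst"
    then show ?thesis by (intro A.card_le) simp_all
  next
    assume "?small snd"
    then show ?thesis by (intro B.card_le) simp_all
  qed
qed

theorem theorem1p1:
  shows "\<exists>\<epsilon> :: nat \<Rightarrow> real.
           (\<forall>k\<ge>2. \<epsilon> k \<ge> 0) \<and> \<epsilon> \<longlonglongrightarrow> 0 \<and>
           (\<forall>k n. k \<ge> 2 \<longrightarrow> n \<ge> 1 \<longrightarrow>
              real (f2 n k) \<le> real (n div k) + (1 + \<epsilon> k) * real k * real ((2*k) choose k))"
proof -
  \<comment> \<open>The error term for w = 2k: a polynomial in \<open>k\<close> times an
    exponentially small ratio.\<close>
  define \<epsilon> :: "nat \<Rightarrow> real" where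
    "\<epsilon> k = (real k * real (2 * k))\<^sup>2 * real ((2 * k) choose k) / real ((3 * k) choose k)" for k
  have nonneg: "\<epsilon> k \<ge> 0" for k by (simp add: \<epsilon>_def)
  have "\<epsilon> \<longlonglongrightarrow> 0"
  proof (rule tendsto_sandwich[OF _ _ tendsto_const])
    show "(\<lambda>k. (real k * real (2 * k))\<^sup>2 * (2 / 3) ^ k) \<longlonglongrightarrow> 0"
      by real_asymp
    show "\<forall>\<^sub>F k in sequentially. \<epsilon> k \<le> (real k * real (2 * k))\<^sup>2 * (2 / 3) ^ k"
      unfolding \<epsilon>_def times_divide_eq_right[symmetric]
      by (intro always_eventually allI mult_left_mono central_binomial_ratio_le) simp
  qed (use nonneg in simp)
  moreover have "real (f2 n k) \<le> real (n div k) + (1 + \<epsilon> k) * real k * real ((2*k) choose k)"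
    (is "_ \<le> ?r") if "k \<ge> 2" for k n
  proof -
    let ?G = "xor_product (KG n k) (KG n k)"
    \<comment> \<open>The clique number is a supremum of naturals, so the real bound is rounded down
      before the supremum is taken.\<close>
    have "f2 n k \<le> nat \<lfloor>?r\<rfloor>"
      unfolding f2_def clique_number_def
    proof (rule cSup_least)
      have "is_clique ?G {}" by (simp add: is_clique_def)
      then show "{card C |C. finite C \<and> is_clique ?G C} \<noteq> {}" by blast
    next
      fix m assume "m \<in> {card C |C. finite C \<and> is_clique ?G C}"
      then have "real m \<le> ?r"
        using clique_xor_KG_card_le[of k _ n] that unfolding \<epsilon>_def by auto
      then show "m \<le> nat \<lfloor>?r\<rfloor>" by (rule le_nat_floor)
    qed
    moreover have "?r \<ge> 0" using nonneg[of k] by simp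
    ultimately show ?thesis by linarith
  qed
  ultimately show ?thesis using nonneg by blast
qed

end
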